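(* For each (large) positive integer $N$ let $\epsilon_1,\dots,\epsilon_N$ be positive real numbers (depending on $N$) such that $$\epsilon_k=\frac{\pi}{N}+\frac{\alpha(k)}{N^2}+O\!\left(\frac1{N^3}\right),\qquad 1\le k\le N,$$ where the real numbers $\alpha(k)=\alpha_N(k)$ are bounded (uniformly in $k$ and $N$), the $O(1/N^3)$ is uniform in $k$, and $\alpha(k)+\alpha(N-k)=O(1/N)$ for $1\le k\le N-1$, uniformly in $k$. Let $f_k(z)=\frac{z}{1-z}+\epsilon_k^2$. Then for every compact set $K\subset\mathbb{C}$, $$f_N\circ f_{N-1}\circ\cdots\circ f_2\circ f_1\longrightarrow \mathrm{Id}\quad\text{on }K\text{, uniformly, as } N\to\infty.$$
   Context: Each $f_k$ is a Möbius transformation of the Riemann sphere $\mathbb{C}\cup\{\infty\}$, and the compositions are taken as Möbius transformations. The sequence $\epsilon_1,\dots,\epsilon_N$ and the numbers $\alpha(k)$ are allowed to change with $N$; all bounds and implied constants are independent of $N$ and $k$. *)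

theory Defs
  imports "HOL-Analysis.Analysis"
begin

datatype riemann_sphere = Fin (finite_part: complex) | Infty

text \<open>
  The Moebius transformation of the sphere with coefficient matrix \<open>(a, b; c, d)\<close>,
  meaningful for \<open>a * d - b * c \<noteq> 0\<close>.
\<close>

fun moebius :: "complex \<Rightarrow> complex \<Rightarrow> complex \<Rightarrow> complex \<Rightarrow> riemann_sphere \<Rightarrow> riemann_sphere" where
  "moebius a b c d (Fin z) = (if c * z + d = 0 then Infty else Fin ((a * z + b) / (c * z + d)))"
| "moebius a b c d Infty = (if c = 0 then Infty else Fin (a / c))"

text \<open>
  The map \<open>z / (1 - z) + e\<^sup>2\<close> on the sphere: the pole \<open>1\<close> is sent to \<open>\<infinity>\<close>, and
  \<open>\<infinity>\<close> to the limit \<open>-1 + e\<^sup>2\<close>.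
\<close>

fun step_map :: "real \<Rightarrow> riemann_sphere \<Rightarrow> riemann_sphere" where
  "step_map e (Fin z) = (if z = 1 then Infty else Fin (z / (1 - z) + (of_real e)\<^sup>2))"
| "step_map e Infty = Fin (- 1 + (of_real e)\<^sup>2)"

text \<open>The coefficient matrix below has determinant \<open>1\<close>.\<close>

lemma step_map_eq_moebius:
  "step_map e = moebius (1 - (of_real e)\<^sup>2) ((of_real e)\<^sup>2) (- 1) 1"
proof
  fix x show "step_map e x = moebius (1 - (of_real e)\<^sup>2) ((of_real e)\<^sup>2) (- 1) 1 x"
    by (cases x) (auto simp: field_simps)
qed

primrec iterated_comp :: "(nat \<Rightarrow> 'a \<Rightarrow> 'a) \<Rightarrow> nat \<Rightarrow> 'a \<Rightarrow> 'a" where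
  "iterated_comp f 0 = id"
| "iterated_comp f (Suc n) = f (Suc n) \<circ> iterated_comp f n"

end

theory Submission
  imports Defs
begin


text \<open>
  In homogeneous coordinates \<open>(p : q)\<close> the orbit satisfies
  \<open>q\<^sub>k\<^sub>+\<^sub>1 - 2 q\<^sub>k + q\<^sub>k\<^sub>-\<^sub>1 = - \<epsilon>\<^sub>k\<^sup>2 q\<^sub>k\<close>. If \<open>\<epsilon>\<^sub>k\<^sup>2\<close> were exactly
  \<open>2 - 2 cos \<theta>\<close> with \<open>\<theta> = \<pi> / N\<close>, the solutions would be trigonometric and
  \<open>(p\<^sub>N, q\<^sub>N) = - (p\<^sub>0, q\<^sub>0)\<close>. In general \<open>\<epsilon>\<^sub>k\<^sup>2 = 2 - 2 cos \<theta> + \<beta>\<^sub>k\<close> with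
  \<open>\<beta>\<^sub>k = 2 \<pi> \<alpha>(k) / N\<^sup>3 + O(N\<^sup>-\<^sup>4)\<close>, and the Wronskian with a trigonometric solution
  expresses \<open>p\<^sub>N + p\<^sub>0\<close> and \<open>q\<^sub>N + q\<^sub>0\<close> through sums of \<open>\<beta>\<^sub>k q\<^sub>k\<close>. Since
  \<open>q\<^sub>k = - z sin (k \<theta>) / sin \<theta> + O(1)\<close> may be of order \<open>N\<close>, size alone bounds
  \<open>p\<^sub>N + p\<^sub>0\<close> by \<open>O(1 / N)\<close> but \<open>q\<^sub>N + q\<^sub>0\<close> only by \<open>O(1)\<close>. Its main part is a multiple of
  \<open>\<Sum>\<^sub>k \<alpha>(k) sin\<^sup>2 (k \<theta>)\<close>, and the symmetry \<open>k \<mapsto> N - k\<close> of the weights gains the missing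
  factor \<open>1 / N\<close>.
\<close>

section \<open>Homogeneous coordinates and the discrete Wronskian\<close>

fun hom_orbit :: "(nat \<Rightarrow> real) \<Rightarrow> complex \<Rightarrow> nat \<Rightarrow> complex \<times> complex" where
  "hom_orbit e z 0 = (z, 1)"
| "hom_orbit e z (Suc n) = (case hom_orbit e z n of (p, q) \<Rightarrow>
     (p + (of_real (e (Suc n)))\<^sup>2 * (q - p), q - p))"

text \<open>The claim that \<open>p n\<close> and \<open>q n\<close> never vanish together is
  carried through the induction: at an infinite value it gives
  \<open>q (Suc n) = - p n \<noteq> 0\<close>, so the orbit returns to the finite plane with value
  \<open>- 1 + e\<^sup>2\<close>.\<close>

lemma iterated_comp_step_map:
  fixes p q :: "nat \<Rightarrow> complex"
  assumes p0: "p 0 = z" and q0: "q 0 = 1"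
    and pS: "\<And>k. p (Suc k) = p k + (of_real (e (Suc k)))\<^sup>2 * q (Suc k)"
    and qS: "\<And>k. q (Suc k) = q k - p k"
  shows "iterated_comp (\<lambda>k. step_map (e k)) n (Fin z) = (if q n = 0 then Infty else Fin (p n / q n))
    \<and> (p n \<noteq> 0 \<or> q n \<noteq> 0)"
proof (induction n)
  case 0
  then show ?case by (simp add: p0 q0)
next
  case (Suc n)
  show ?case
  proof (cases "q n = 0")
    case True
    then show ?thesis using Suc by (simp add: pS qS field_simps)
  next
    case False
    then have "p n / q n = 1 \<longleftrightarrow> q (Suc n) = 0" by (auto simp: qS)
    moreover have "p n / q n / (1 - p n / q n) = p n / q (Suc n)" if "q (Suc n) \<noteq> 0"
      using False that by (simp add: qS field_simps)
    moreover have "p n \<noteq> 0" if "q (Suc n) = 0" using False that by (auto simp: qS)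
    ultimately show ?thesis using Suc False 
      by (auto simp: pS field_simps)
  qed
qed

text \<open>As \<open>p n = q n - q (Suc n)\<close>, the left side is the Casoratian
  \<open>q (Suc n) * t n - q n * t (Suc n)\<close>. It would be constant if \<open>q\<close> solved
  the same recurrence as \<open>t\<close>; each perturbation \<beta> changes it by one term of the
  sum.\<close>

lemma wronskian:
  fixes p q :: "nat \<Rightarrow> complex" and t \<beta> :: "nat \<Rightarrow> real"
  assumes pS: "\<And>k. p (Suc k) = p k + of_real (d + \<beta> (Suc k)) * q (Suc k)"
    and qS: "\<And>k. q (Suc k) = q k - p k"
    and t: "\<And>k. t (Suc (Suc k)) = (2 - d) * t (Suc k) - t k"
  shows "q n * of_real (t n - t (Suc n)) - p n * of_real (t n)
    = q 0 * of_real (t 0 - t (Suc 0)) - p 0 * of_real (t 0) - (\<Sum>k=1..n. of_real (\<beta> k * t k) * q k)"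
proof (induction n)
  case 0
  then show ?case by simp
next
  case (Suc n)
  have "q (Suc n) * of_real (t (Suc n) - t (Suc (Suc n))) - p (Suc n) * of_real (t (Suc n))
    = q n * of_real (t n - t (Suc n)) - p n * of_real (t n) - of_real (\<beta> (Suc n) * t (Suc n)) * q (Suc n)"
    unfolding pS t by (simp add: qS algebra_simps)
  then show ?case using Suc by simp
qed

section \<open>Elementary estimates for the sine and the chord\<close>

lemma abs_sin_minus_self_le: "\<bar>sin x - x\<bar> \<le> \<bar>x\<bar> ^ 3 / 6" for x :: real
proof -
  have "{..<3::nat} = {0, 1, 2}" by auto
  \<comment> \<open>The quadratic coefficient vanishes, so three terms of the series already give
    \<open>x\<close> and the remainder is cubic.\<close>
  then have "(\<Sum>m<3. sin_coeff m * x ^ m) = x"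
    by (simp add: sin_coeff_def)
  then show ?thesis using Maclaurin_sin_bound[of x 3] by (simp add: fact_numeral field_simps)
qed

text \<open>Dividing by sin \<theta> will therefore cost at most a factor N / 2. For N >= 4 the
  angle is at most 1, where the cubic error is at most x / 6.\<close>

lemma sin_pi_div_ge:
  fixes N :: nat
  assumes "N \<ge> 4"
  shows "2 / real N \<le> sin (pi / real N)"
proof -
  define x where "x = pi / real N"
  have x: "0 < x" "x \<le> 1" using assms pi_less_4 by (auto simp: x_def field_simps)
  have "x ^ 3 \<le> x" using x power_decreasing[of 1 3 x] by simp
  moreover have "\<bar>sin x - x\<bar> \<le> x ^ 3 / 6"
    using abs_sin_minus_self_le[of x] x by simp
  ultimately have "5 / 6 * x \<le> sin x" by linarith
  moreover have "3 / real N \<le> x" using pi_gt3 by (simp add: x_def divide_right_mono)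
  ultimately have "5 / 6 * (3 / real N) \<le> sin x" by linarith
  moreover have "2 / real N \<le> 5 / 6 * (3 / real N)" using assms by (simp add: field_simps)
  ultimately show ?thesis unfolding x_def by linarith
qed

lemma abs_sin_diff_le: "\<bar>sin x - sin y\<bar> \<le> \<bar>x - y\<bar>" for x y :: real
proof -
  have "\<bar>sin x - sin y\<bar> = 2 * \<bar>sin ((x - y) / 2)\<bar> * \<bar>cos ((x + y) / 2)\<bar>"
    by (simp add: sin_diff_sin abs_mult)
  also have "\<dots> \<le> 2 * \<bar>(x - y) / 2\<bar> * 1"
    by (intro mult_mono abs_sin_x_le_abs_x) auto
  finally show ?thesis by simp
qed

text \<open>The chord squared is 4 sin^2 (x / 2), so with y = x / 2 the difference factors as 4 (y -
  sin y) (y + sin y): a cubic factor times a linear one.\<close>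

lemma chord_square_bound: "\<bar>x\<^sup>2 - (2 - 2 * cos x)\<bar> \<le> x ^ 4 / 12" for x :: real
proof -
  define y where "y = x / 2"
  have "cos x = 1 - 2 * (sin y)\<^sup>2" using cos_double_sin[of y] by (simp add: y_def)
  moreover have "x\<^sup>2 = 4 * y\<^sup>2" by (simp add: y_def power_divide)
  ultimately have "x\<^sup>2 - (2 - 2 * cos x) = 4 * ((y - sin y) * (y + sin y))"
    by (simp add: power2_eq_square algebra_simps)
  then have "\<bar>x\<^sup>2 - (2 - 2 * cos x)\<bar> = 4 * (\<bar>sin y - y\<bar> * \<bar>y + sin y\<bar>)"
    by (simp add: abs_mult abs_minus_commute)
  also have "\<dots> \<le> 4 * (\<bar>y\<bar> ^ 3 / 6 * (2 * \<bar>y\<bar>))"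
    using abs_sin_minus_self_le[of y] abs_sin_x_le_abs_x[of y]
    by (intro mult_mono) auto
  also have "\<dots> = y ^ 4 * (4 / 3)"
    by (simp add: power3_eq_cube power4_eq_xxxx abs_mult_self_eq flip: mult.assoc)
  also have "\<dots> = x ^ 4 / 12" by (simp add: y_def power_divide)
  finally show ?thesis .
qed

section \<open>Perturbation of the trigonometric orbit\<close>

text \<open>The numerators involve only R, b, C and D, which makes the bounds uniform in N and over
  starting points in the disc of radius R. The condition \<open>b \<le> real N\<close> lets the
  perturbation be absorbed in the a priori bound on \<open>q\<close>.\<close>

lemma hom_orbit_near_minus_identity:
  fixes p q :: "nat \<Rightarrow> complex" and \<beta> \<alpha> :: "nat \<Rightarrow> real" and N :: nat and b C D R :: real
  defines "\<theta> \<equiv> pi / real N"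
  assumes pS: "\<And>k. p (Suc k) = p k + of_real (2 - 2 * cos \<theta> + \<beta> (Suc k)) * q (Suc k)"
    and qS: "\<And>k. q (Suc k) = q k - p k"
    and q0: "q 0 = 1" and p0: "norm (p 0) \<le> R"
    and N: "N \<ge> 4" "b \<le> real N"
    and \<beta>: "\<And>k. k \<in> {1..N} \<Longrightarrow> \<bar>\<beta> k\<bar> \<le> b / real N ^ 3"
    and \<alpha>: "\<And>k. k \<in> {1..N} \<Longrightarrow> \<bar>\<beta> k - 2 * pi * \<alpha> k / real N ^ 3\<bar> \<le> C / real N ^ 4"
    and antisym: "\<And>k. k \<in> {1..N - 1} \<Longrightarrow> \<bar>\<alpha> k + \<alpha> (N - k)\<bar> \<le> D / real N"
  shows "norm (p N + p 0) \<le> 4 * b * (R / 2 + 1) / real N" (is ?p)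
    and "norm (q N + 1) \<le> (b * (2 + b * (R / 2 + 1)) / 2 + R * (pi * D / 4 + C / 4)) / real N" (is ?q)
proof -
  define S where "S = sin \<theta>"
  have Npos: "real N > 0" using N by simp
  have Nt: "real N * \<theta> = pi" using Npos by (simp add: \<theta>_def)
  have \<theta>: "0 < \<theta>" "\<theta> \<le> 1" using N pi_less_4 by (auto simp: \<theta>_def field_simps)
  have S: "2 / real N \<le> S" using sin_pi_div_ge[OF N(1)] by (simp add: S_def \<theta>_def)
  then have Spos: "0 < S" using Npos by (smt (verit) divide_pos_pos)
  have invS: "1 / S \<le> real N / 2" using S Spos Npos by (simp add: field_simps)
  have R: "0 \<le> R" using p0 norm_ge_zero by (rule order_trans[rotated])
  have b: "0 \<le> b"
    using order_trans[OF abs_ge_zero \<beta>[of 1]] N by (simp add: zero_le_divide_iff)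

  \<comment> \<open>Variation of constants: the test solution sin ((n - k) \<theta>) vanishes at k =
    n, which removes \<open>p n\<close>, and equals - S at k = n + 1, which leaves S times
    \<open>q n\<close>.\<close>
  have rep: "q n + p 0 * of_real (sin (real n * \<theta>) / S) = of_real ((sin (real n * \<theta>) - sin (real n * \<theta> - \<theta>)) / S)
      - (\<Sum>k=1..n. of_real (\<beta> k * (sin (real n * \<theta> - real k * \<theta>) / S)) * q k)" for n
  proof -
    define t where "t k = sin (real n * \<theta> - real k * \<theta>)" for k
    have rec: "t (Suc (Suc k)) = (2 - (2 - 2 * cos \<theta>)) * t (Suc k) - t k" for k
    proof -
      define u where "u = real n * \<theta> - real (Suc k) * \<theta>"
      have "t (Suc (Suc k)) = sin (u - \<theta>)" "t k = sin (u + \<theta>)" "t (Suc k) = sin u"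
        by (simp_all add: t_def u_def algebra_simps)
      then show ?thesis by (simp add: sin_diff sin_add)
    qed
    have tn: "t n = 0" "t (Suc n) = - S" "t 0 = sin (real n * \<theta>)" "t (Suc 0) = sin (real n * \<theta> - \<theta>)"
      by (simp_all add: t_def S_def ring_distribs flip: sin_minus)
    have "q n * of_real S = of_real (t 0 - t (Suc 0)) - p 0 * of_real (t 0)
        - (\<Sum>k=1..n. of_real (\<beta> k * t k) * q k)"
      using wronskian[of p "2 - 2 * cos \<theta>" \<beta> q t n, OF pS qS rec] unfolding q0 tn by simp
    then have "q n = (of_real (t 0 - t (Suc 0)) - p 0 * of_real (t 0)
        - (\<Sum>k=1..n. of_real (\<beta> k * t k) * q k)) / of_real S"
      using Spos by (simp add: field_simps)
    then show ?thesis
      using Spos unfolding tn t_def by (simp add: diff_divide_distrib sum_divide_distrib)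
  qed

  have free: "norm (complex_of_real ((sin (real n * \<theta>) - sin (real n * \<theta> - \<theta>)) / S)) \<le> 2" for n
  proof -
    have "\<bar>sin (real n * \<theta>) - sin (real n * \<theta> - \<theta>)\<bar> \<le> \<theta>"
      using abs_sin_diff_le[of "real n * \<theta>" "real n * \<theta> - \<theta>"] \<theta> by simp
    also have "\<dots> \<le> 2 * S"
    proof -
      have "\<theta> \<le> 4 / real N" using pi_less_4 by (simp add: \<theta>_def divide_right_mono)
      with S show ?thesis by (simp add: field_simps)
    qed
    finally show ?thesis unfolding norm_of_real using Spos by (simp add: field_simps)
  qed

  have coeff: "\<bar>\<beta> k * (sin x / S)\<bar> \<le> b / (2 * real N ^ 2)" if "k \<in> {1..N}" for k x
  proof -
    have "\<bar>sin x / S\<bar> \<le> 1 / S" using Spos by (simp add: divide_right_mono)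
    then have "\<bar>\<beta> k * (sin x / S)\<bar> \<le> b / real N ^ 3 * (real N / 2)"
      unfolding abs_mult using \<beta>[OF that] invS b
      by (intro mult_mono order_trans[OF _ invS]) (auto simp del: abs_divide)
    then show ?thesis using Npos by (simp add: power3_eq_cube power2_eq_square)
  qed

  \<comment> \<open>Bound for the unperturbed solution: R / S <= R N / 2 from \<open>p 0\<close>,
    and 2 from \<open>free\<close>.\<close>
  define A where "A = R * real N / 2 + 2"
  have A: "0 \<le> A" using R Npos by (simp add: A_def)
  have perturb: "norm (\<Sum>k=1..n. of_real (\<beta> k * (sin (real n * \<theta> - real k * \<theta>) / S)) * q k) \<le> b / (2 * real N) * M"
    if "n \<le> N" "\<And>k. k \<in> {1..<n} \<Longrightarrow> norm (q k) \<le> M" "0 \<le> M" for n M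
  proof -
    have "norm (\<Sum>k=1..n. of_real (\<beta> k * (sin (real n * \<theta> - real k * \<theta>) / S)) * q k)
        \<le> of_nat (card {1..n}) * (b / (2 * real N ^ 2) * M)"
    proof (rule sum_norm_bound)
      fix k assume k: "k \<in> {1..n}"
      show "norm (of_real (\<beta> k * (sin (real n * \<theta> - real k * \<theta>) / S)) * q k) \<le> b / (2 * real N ^ 2) * M"
      \<comment> \<open>The term k = n contains sin 0, so bounds on strictly earlier values of
        \<open>q\<close> suffice; this permits the strong induction in \<open>crude\<close>.\<close>
      proof (cases "k = n")
        case True
        then show ?thesis using b that by simp
      next
        case False
        then show ?thesis unfolding norm_mult norm_of_real
          using coeff[of k] k that b by (intro mult_mono) auto
      qed
    qed
    also have "\<dots> \<le> real N * (b / (2 * real N ^ 2) * M)"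
      using that b by (intro mult_right_mono) auto
    also have "\<dots> = b / (2 * real N) * M" using Npos by (simp add: power2_eq_square)
    finally show ?thesis .
  qed

  \<comment> \<open>By induction the perturbation contributes at most (b / (2 N)) 2 A, and this is
    at most A because b <= N; together with the unperturbed bound A it gives 2 A.\<close>
  have crude: "n \<le> N \<Longrightarrow> norm (q n) \<le> 2 * A" for n
  proof (induction n rule: less_induct)
    case (less n)
    have "norm (q n + p 0 * of_real (sin (real n * \<theta>) / S)) \<le> 2 + b / (2 * real N) * (2 * A)"
      unfolding rep using less A
      by (intro order_trans[OF norm_triangle_ineq4] add_mono free perturb) auto
    moreover have "b / (2 * real N) * (2 * A) \<le> 1 / 2 * (2 * A)"
      using N A Npos by (intro mult_right_mono) (auto simp: field_simps)
    moreover have "norm (p 0 * of_real (sin (real n * \<theta>) / S)) \<le> R * (real N / 2)"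
    proof -
      have "\<bar>sin (real n * \<theta>) / S\<bar> \<le> 1 / S" using Spos by (simp add: divide_right_mono)
      then show ?thesis unfolding norm_mult norm_of_real
        using p0 R by (intro mult_mono order_trans[OF _ invS]) (auto simp del: abs_divide)
    qed
    ultimately show ?case
      using norm_diff_ineq[of "q n" "p 0 * of_real (sin (real n * \<theta>) / S)"] A_def by linarith
  qed

  define G where "G = 2 + b * (R / 2 + 1)"
  have A_le: "A / real N \<le> R / 2 + 1"
    using N by (simp add: A_def add_divide_distrib divide_le_eq)
  \<comment> \<open>Second pass: with \<open>crude\<close> inserted in the sum, everything except
    the sine term of order N is bounded independently of N.\<close>
  have fine: "norm (q n + p 0 * of_real (sin (real n * \<theta>) / S)) \<le> G" if "n \<le> N" for n
  proof -
    have "norm (q n + p 0 * of_real (sin (real n * \<theta>) / S)) \<le> 2 + b / (2 * real N) * (2 * A)"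
      unfolding rep using that A crude
      by (intro order_trans[OF norm_triangle_ineq4] add_mono free perturb) auto
    also have "b / (2 * real N) * (2 * A) = b * (A / real N)" by simp
    also have "\<dots> \<le> b * (R / 2 + 1)" using A_le b by (rule mult_left_mono)
    finally show ?thesis by (simp add: G_def)
  qed

  show ?p
  proof -
    \<comment> \<open>The half-step shift gives \<open>t 0 = t (Suc 0)\<close> and
      \<open>t N = t (Suc N)\<close>, so \<open>q\<close> drops out of the Wronskian at both ends.
      As \<open>t N = - t 0\<close>, what remains is a multiple of \<open>p N + p 0\<close>.\<close>
    define t where "t k = cos (real k * \<theta> - \<theta> / 2)" for k
    have rec: "t (Suc (Suc k)) = (2 - (2 - 2 * cos \<theta>)) * t (Suc k) - t k" for k
    proof -
      define u where "u = real (Suc k) * \<theta> - \<theta> / 2"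
      have "t (Suc (Suc k)) = cos (u + \<theta>)" "t k = cos (u - \<theta>)" "t (Suc k) = cos u"
        by (simp_all add: t_def u_def algebra_simps)
      then show ?thesis by (simp add: cos_diff cos_add)
    qed
    have tv: "t 0 = cos (\<theta> / 2)" "t (Suc 0) = cos (\<theta> / 2)" "t N = - cos (\<theta> / 2)" "t (Suc N) = - cos (\<theta> / 2)"
    proof -
      show "t (Suc N) = - cos (\<theta> / 2)"
      proof -
        have "real (Suc N) * \<theta> - \<theta> / 2 = pi + \<theta> / 2" using Nt by (simp add: algebra_simps)
        then show ?thesis by (simp add: t_def)
      qed
    qed (simp_all add: t_def Nt cos_diff)
    have "p N * of_real (cos (\<theta> / 2)) = - (p 0 * of_real (cos (\<theta> / 2))) - (\<Sum>k=1..N. of_real (\<beta> k * t k) * q k)"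
      using wronskian[of p "2 - 2 * cos \<theta>" \<beta> q t N, OF pS qS rec] unfolding tv
      by simp
    then have eq: "(p N + p 0) * of_real (cos (\<theta> / 2)) = - (\<Sum>k=1..N. of_real (\<beta> k * t k) * q k)"
      by (simp add: distrib_right)
    have c: "1 / 2 \<le> cos (\<theta> / 2)"
      using cos_monotone_0_pi_le[of "\<theta> / 2" "pi / 3"] \<theta> pi_gt3 by (simp add: cos_60)
    have "norm (p N + p 0) * (1 / 2) \<le> norm (p N + p 0) * cos (\<theta> / 2)"
      using c by (intro mult_left_mono) auto
    also have "\<dots> = norm (\<Sum>k=1..N. of_real (\<beta> k * t k) * q k)"
      using arg_cong[OF eq, of norm] c by (simp add: norm_mult)
    also have "\<dots> \<le> of_nat (card {1..N}) * (b / real N ^ 3 * (2 * A))"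
    proof (rule sum_norm_bound)
      fix k assume k: "k \<in> {1..N}"
      have "\<bar>\<beta> k\<bar> * \<bar>t k\<bar> \<le> b / real N ^ 3 * 1"
        using \<beta>[OF k] b by (intro mult_mono) (auto simp: t_def)
      then show "norm (of_real (\<beta> k * t k) * q k) \<le> b / real N ^ 3 * (2 * A)"
        unfolding norm_mult norm_of_real abs_mult
        using crude[of k] k b by (intro mult_mono) auto
    qed
    also have "\<dots> = 2 * b * (A / real N) / real N" using Npos by (simp add: power3_eq_cube)
    also have "\<dots> \<le> 2 * b * (R / 2 + 1) / real N"
      using A_le b Npos by (intro divide_right_mono mult_left_mono) auto
    finally show ?thesis by simp
  qed

  show ?q
  proof -
    define s where "s k = sin (real k * \<theta>)" for k
    \<comment> \<open>\<open>r\<close> is \<open>q\<close> with its part of order N removed;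
      \<open>fine\<close> bounds it by \<open>G\<close>.\<close>
    define r where "r k = q k + p 0 * of_real (s k / S)" for k
    have refl: "s (N - k) = s k" if "k \<le> N" for k
      using that Nt by (simp add: s_def of_nat_diff left_diff_distrib sin_diff)
    have sN: "s N = 0" by (simp add: s_def Nt)
    have qN: "q N = - 1 - (\<Sum>k=1..N. of_real (\<beta> k * (s k / S)) * q k)"
    proof -
      have "sin (real N * \<theta> - real k * \<theta>) = s k" for k
        by (simp add: s_def Nt sin_diff)
      moreover have "(sin (real N * \<theta>) - sin (real N * \<theta> - \<theta>)) / S = - 1"
        using Spos by (simp add: Nt sin_diff S_def)
      ultimately show ?thesis using rep[of N] by (simp add: Nt)
    qed
    have split: "(\<Sum>k=1..N. of_real (\<beta> k * (s k / S)) * q k)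
        = (\<Sum>k=1..N. of_real (\<beta> k * (s k / S)) * r k) - p 0 * of_real (\<Sum>k=1..N. \<beta> k * (s k / S)\<^sup>2)"
    proof -
      have "of_real (\<beta> k * (s k / S)) * q k
          = of_real (\<beta> k * (s k / S)) * r k - p 0 * of_real (\<beta> k * (s k / S)\<^sup>2)" for k
        by (simp add: r_def distrib_left power2_eq_square mult_ac)
      then show ?thesis by (simp only: sum_subtractf of_real_sum sum_distrib_left)
    qed
    \<comment> \<open>The second sum is O(1 / N) by size alone. The first has weights of order N^2
      and needs the cancellation in \<alpha>.\<close>
    have eq: "q N + 1 = p 0 * of_real (\<Sum>k=1..N. \<beta> k * (s k / S)\<^sup>2)
        - (\<Sum>k=1..N. of_real (\<beta> k * (s k / S)) * r k)"
    proof -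
      have "- 1 - (u - v) + 1 = v - u" for u v :: complex by simp
      then show ?thesis by (simp only: qN split)
    qed
    have rem: "norm (\<Sum>k=1..N. of_real (\<beta> k * (s k / S)) * r k) \<le> b * G / 2 / real N"
    proof -
      have "norm (\<Sum>k=1..N. of_real (\<beta> k * (s k / S)) * r k) \<le> of_nat (card {1..N}) * (b / (2 * real N ^ 2) * G)"
      proof (rule sum_norm_bound)
        fix k assume k: "k \<in> {1..N}"
        show "norm (of_real (\<beta> k * (s k / S)) * r k) \<le> b / (2 * real N ^ 2) * G"
          unfolding norm_mult norm_of_real r_def s_def
          using coeff[OF k] fine[of k] k b by (intro mult_mono) auto
      qed
      also have "\<dots> = b * G / 2 / real N" using Npos by (simp add: power2_eq_square)
      finally show ?thesis .
    qed
    have sq: "(s k / S)\<^sup>2 \<le> real N ^ 2 / 4" for k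
    proof -
      have "\<bar>s k / S\<bar> \<le> 1 / S" using Spos by (simp add: s_def divide_right_mono)
      then have "\<bar>s k / S\<bar> \<le> real N / 2" using invS by linarith
      then have "\<bar>s k / S\<bar> ^ 2 \<le> (real N / 2) ^ 2" by (intro power_mono) auto
      then show ?thesis by (simp add: power_divide)
    qed
    \<comment> \<open>The term k = N, which has no partner under k -> N - k, vanishes since
      \<open>s N = 0\<close>. Adding the rest to its reflection puts \<alpha>(k) + \<alpha>(N - k)
      in twice the sum: fewer than N terms of size (D / N) (N^2 / 4).\<close>
    have main: "\<bar>\<Sum>k=1..N. \<alpha> k * (s k / S)\<^sup>2\<bar> \<le> D * real N ^ 2 / 8"
    proof -
      let ?w = "\<lambda>k. (s k / S)\<^sup>2"
      have "(\<Sum>k=1..N. \<alpha> k * ?w k) = (\<Sum>k=1..N-1. \<alpha> k * ?w k)"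
      proof -
        have "{1..N} = insert N {1..N-1}" using N by auto
        then show ?thesis using N by (simp add: sN)
      qed
      moreover have "(\<Sum>k=1..N-1. \<alpha> k * ?w k) = (\<Sum>k=1..N-1. \<alpha> (N - k) * ?w k)"
        by (rule sum.reindex_bij_witness[of _ "\<lambda>k. N - k" "\<lambda>k. N - k"]) (auto simp: refl)
      ultimately have "2 * (\<Sum>k=1..N. \<alpha> k * ?w k) = (\<Sum>k=1..N-1. (\<alpha> k + \<alpha> (N - k)) * ?w k)"
        by (simp add: ring_distribs sum.distrib)
      moreover have "norm (\<Sum>k=1..N-1. (\<alpha> k + \<alpha> (N - k)) * ?w k) \<le> of_nat (card {1..N-1}) * (D / real N * (real N ^ 2 / 4))"
      proof (rule sum_norm_bound)
        fix k assume k: "k \<in> {1..N-1}"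
        show "norm ((\<alpha> k + \<alpha> (N - k)) * ?w k) \<le> D / real N * (real N ^ 2 / 4)"
          unfolding norm_mult using antisym[OF k] sq[of k] 
          by (intro mult_mono order_trans[OF abs_ge_zero antisym[OF k]]) auto
      qed
      moreover have "of_nat (card {1..N-1}) * (D / real N * (real N ^ 2 / 4)) \<le> real N * (D / real N * (real N ^ 2 / 4))"
        using order_trans[OF abs_ge_zero antisym[of 1]] N by (intro mult_right_mono mult_nonneg_nonneg) auto
      moreover have "real N * (D / real N * (real N ^ 2 / 4)) = D * real N ^ 2 / 4" using Npos by simp
      ultimately show ?thesis unfolding real_norm_def by linarith
    qed
    have sum\<beta>: "\<bar>\<Sum>k=1..N. \<beta> k * (s k / S)\<^sup>2\<bar> \<le> (pi * D / 4 + C / 4) / real N"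
    proof -
      let ?w = "\<lambda>k. (s k / S)\<^sup>2"
      \<comment> \<open>Only the leading part of \<beta> has cancellation; the error of order
        N^(-4), with N weights of size N^2 / 4, is O(1 / N) directly.\<close>
      have "(\<Sum>k=1..N. \<beta> k * ?w k) = 2 * pi / real N ^ 3 * (\<Sum>k=1..N. \<alpha> k * ?w k)
          + (\<Sum>k=1..N. (\<beta> k - 2 * pi * \<alpha> k / real N ^ 3) * ?w k)"
        by (simp add: sum_distrib_left left_diff_distrib sum_subtractf mult.assoc)
      moreover have "norm (\<Sum>k=1..N. (\<beta> k - 2 * pi * \<alpha> k / real N ^ 3) * ?w k)
          \<le> of_nat (card {1..N}) * (C / real N ^ 4 * (real N ^ 2 / 4))"
      proof (rule sum_norm_bound)
        fix k assume k: "k \<in> {1..N}"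
        show "norm ((\<beta> k - 2 * pi * \<alpha> k / real N ^ 3) * ?w k) \<le> C / real N ^ 4 * (real N ^ 2 / 4)"
          unfolding norm_mult using \<alpha>[OF k] sq[of k] 
          by (intro mult_mono order_trans[OF abs_ge_zero \<alpha>[OF k]]) auto
      qed
      moreover have "\<bar>2 * pi / real N ^ 3 * (\<Sum>k=1..N. \<alpha> k * ?w k)\<bar> \<le> 2 * pi / real N ^ 3 * (D * real N ^ 2 / 8)"
        unfolding abs_mult using main Npos by (intro mult_mono) auto
      moreover have "2 * pi / real N ^ 3 * (D * real N ^ 2 / 8) + of_nat (card {1..N}) * (C / real N ^ 4 * (real N ^ 2 / 4))
          = (pi * D / 4 + C / 4) / real N"
        using Npos by (simp add: field_simps power2_eq_square power3_eq_cube power4_eq_xxxx)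
      ultimately show ?thesis unfolding real_norm_def by linarith
    qed
    have "norm (q N + 1) \<le> R * ((pi * D / 4 + C / 4) / real N) + b * G / 2 / real N"
      unfolding eq
      by (intro order_trans[OF norm_triangle_ineq4] add_mono rem)
        (unfold norm_mult norm_of_real, intro mult_mono p0 sum\<beta> R, simp)
    then show ?thesis by (simp add: G_def add_divide_distrib algebra_simps)
  qed
qed

section \<open>Expansion of the squared step parameters\<close>

text \<open>Squaring pi / n + (a / n^2 + r) gives the cross term 2 pi a / n^3. The three terms of
  the constant bound the square of the correction, the cross term with r, and the gap between
  squared arc and squared chord.\<close>

lemma step_square_expansion:
  fixes a e n B C :: real
  assumes n: "n \<ge> 1" and a: "\<bar>a\<bar> \<le> B" and e: "\<bar>e - (pi / n + a / n ^ 2)\<bar> \<le> C / n ^ 3"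
  shows "\<bar>e\<^sup>2 - (2 - 2 * cos (pi / n)) - 2 * pi * a / n ^ 3\<bar>
    \<le> ((B + C)\<^sup>2 + 2 * pi * C + pi ^ 4 / 12) / n ^ 4" (is ?fine)
    and "\<bar>e\<^sup>2 - (2 - 2 * cos (pi / n))\<bar>
    \<le> (2 * pi * B + ((B + C)\<^sup>2 + 2 * pi * C + pi ^ 4 / 12)) / n ^ 3" (is ?crude)
proof -
  define r where "r = e - (pi / n + a / n ^ 2)"
  have r: "\<bar>r\<bar> \<le> C / n ^ 3" using e by (simp add: r_def)
  have C: "0 \<le> C" using order_trans[OF abs_ge_zero r] n by (simp add: zero_le_divide_iff)
  have B: "0 \<le> B" using a by linarith
  have eq: "e\<^sup>2 - (2 - 2 * cos (pi / n)) - 2 * pi * a / n ^ 3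
      = (a / n ^ 2 + r)\<^sup>2 + 2 * (pi / n) * r + ((pi / n)\<^sup>2 - (2 - 2 * cos (pi / n)))"
  proof -
    have e_eq: "e = pi / n + (a / n ^ 2 + r)" by (simp add: r_def)
    have "2 * (pi / n) * (a / n ^ 2) = 2 * pi * a / n ^ 3"
      by (simp add: power2_eq_square power3_eq_cube)
    then show ?thesis unfolding e_eq by (simp add: power2_sum distrib_left)
  qed
  have "\<bar>a / n ^ 2 + r\<bar> \<le> B / n ^ 2 + C / n ^ 2"
  proof -
    have "C / n ^ 3 \<le> C / n ^ 2" using n C by (intro divide_left_mono power_increasing) auto
    moreover have "\<bar>a / n ^ 2\<bar> \<le> B / n ^ 2" using a by (simp add: divide_right_mono)
    ultimately show ?thesis using r by linarith
  qed
  then have "\<bar>a / n ^ 2 + r\<bar> ^ 2 \<le> ((B + C) / n ^ 2) ^ 2"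
    by (intro power_mono) (auto simp: add_divide_distrib)
  then have 1: "\<bar>(a / n ^ 2 + r)\<^sup>2\<bar> \<le> (B + C)\<^sup>2 / n ^ 4"
    by (simp add: power_divide flip: power_mult)
  have "\<bar>2 * (pi / n) * r\<bar> \<le> 2 * (pi / n) * (C / n ^ 3)"
    unfolding abs_mult using r n by (intro mult_mono) auto
  then have 2: "\<bar>2 * (pi / n) * r\<bar> \<le> 2 * pi * C / n ^ 4"
    by (simp add: power3_eq_cube power4_eq_xxxx mult.assoc)
  have 3: "\<bar>(pi / n)\<^sup>2 - (2 - 2 * cos (pi / n))\<bar> \<le> pi ^ 4 / 12 / n ^ 4"
    using chord_square_bound[of "pi / n"] by (simp add: power_divide mult.commute)
  show ?fine
    unfolding eq add_divide_distrib using 1 2 3 by linarith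
  moreover have "\<dots> \<le> ((B + C)\<^sup>2 + 2 * pi * C + pi ^ 4 / 12) / n ^ 3"
    using n C by (intro divide_left_mono power_increasing) auto
  moreover have "\<bar>2 * pi * a / n ^ 3\<bar> \<le> 2 * pi * B / n ^ 3"
    using a n by (simp add: abs_mult divide_right_mono)
  ultimately show ?crude
    unfolding add_divide_distrib by linarith
qed

section \<open>Uniform convergence on compact sets\<close>

theorem theorem2:
  fixes \<epsilon> \<alpha> :: "nat \<Rightarrow> nat \<Rightarrow> real" and N0 :: nat
  assumes pos: "\<forall>N\<ge>N0. \<forall>k\<in>{1..N}. \<epsilon> N k > 0"
    and expansion: "\<exists>C. \<forall>N\<ge>N0. \<forall>k\<in>{1..N}.
      \<bar>\<epsilon> N k - (pi / real N + \<alpha> N k / real N ^ 2)\<bar> \<le> C / real N ^ 3"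
    and bounded: "\<exists>B. \<forall>N\<ge>N0. \<forall>k\<in>{1..N}. \<bar>\<alpha> N k\<bar> \<le> B"
    and antisym: "\<exists>D. \<forall>N\<ge>N0. \<forall>k\<in>{1..N - 1}. \<bar>\<alpha> N k + \<alpha> N (N - k)\<bar> \<le> D / real N"
  shows "\<forall>K :: complex set. compact K \<longrightarrow>
      (\<forall>\<^sub>F N in sequentially. \<forall>z\<in>K.
         iterated_comp (\<lambda>k. step_map (\<epsilon> N k)) N (Fin z) \<noteq> Infty) \<and>
      uniform_limit K
        (\<lambda>N z. finite_part (iterated_comp (\<lambda>k. step_map (\<epsilon> N k)) N (Fin z)))
        (\<lambda>z. z) sequentially"
proof (intro allI impI)
  fix K :: "complex set"
  assume "compact K"
  then obtain R where R: "\<And>z. z \<in> K \<Longrightarrow> norm z \<le> R" "0 < R"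
    by (meson compact_imp_bounded bounded_pos)
  obtain C where C: "\<And>N k. N \<ge> N0 \<Longrightarrow> k \<in> {1..N} \<Longrightarrow>
      \<bar>\<epsilon> N k - (pi / real N + \<alpha> N k / real N ^ 2)\<bar> \<le> C / real N ^ 3"
    using expansion by blast
  obtain B where B: "\<And>N k. N \<ge> N0 \<Longrightarrow> k \<in> {1..N} \<Longrightarrow> \<bar>\<alpha> N k\<bar> \<le> B"
    using bounded by blast
  obtain D where D: "\<And>N k. N \<ge> N0 \<Longrightarrow> k \<in> {1..N - 1} \<Longrightarrow> \<bar>\<alpha> N k + \<alpha> N (N - k)\<bar> \<le> D / real N"
    using antisym by blast
  define C' where "C' = (B + C)\<^sup>2 + 2 * pi * C + pi ^ 4 / 12"
  define b where "b = 2 * pi * B + C'"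
  define X where "X = 4 * b * (R / 2 + 1)"
  define Y where "Y = b * (2 + b * (R / 2 + 1)) / 2 + R * (pi * D / 4 + C' / 4)"
  let ?comp = "\<lambda>N z. iterated_comp (\<lambda>k. step_map (\<epsilon> N k)) N (Fin z)"

  \<comment> \<open>The condition 2 Y <= N keeps \<open>q N\<close> within 1 / 2 of - 1. Hence the
    value is finite, so that \<open>finite_part\<close> is meaningful, and dividing by
    \<open>q N\<close> costs only the factor 2.\<close>
  have close: "?comp N z \<noteq> Infty \<and> dist (finite_part (?comp N z)) z \<le> 2 * (X + R * Y) / real N"
    if N: "N \<ge> N0" "N \<ge> 4" "b \<le> real N" "2 * Y \<le> real N" and z: "z \<in> K" for N z
  proof -
    define p where "p k = fst (hom_orbit (\<epsilon> N) z k)" for k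
    define q where "q k = snd (hom_orbit (\<epsilon> N) z k)" for k
    define \<beta> where "\<beta> k = (\<epsilon> N k)\<^sup>2 - (2 - 2 * cos (pi / real N))" for k
    have p0: "p 0 = z" and q0: "q 0 = 1" by (simp_all add: p_def q_def)
    have qS: "q (Suc k) = q k - p k" for k by (simp add: p_def q_def split: prod.split)
    have pS: "p (Suc k) = p k + (of_real (\<epsilon> N (Suc k)))\<^sup>2 * q (Suc k)" for k
      by (simp add: p_def q_def split: prod.split)
    have pS': "p (Suc k) = p k + of_real (2 - 2 * cos (pi / real N) + \<beta> (Suc k)) * q (Suc k)" for k
      by (simp add: pS \<beta>_def)
    have exp: "\<bar>\<beta> k - 2 * pi * \<alpha> N k / real N ^ 3\<bar> \<le> C' / real N ^ 4" "\<bar>\<beta> k\<bar> \<le> b / real N ^ 3"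
      if "k \<in> {1..N}" for k
      using step_square_expansion[OF _ B[OF N(1) that] C[OF N(1) that]] N(2)
      by (simp_all add: \<beta>_def C'_def b_def)
    note near = hom_orbit_near_minus_identity[of p N \<beta> q R b "\<alpha> N" C' D,
        OF pS' qS q0 _ N(2,3) exp(2,1) D[OF N(1)], unfolded p0, OF R(1)[OF z]]
    have P: "norm (p N + z) \<le> X / real N" using near(1) by (simp add: X_def)
    have Q: "norm (q N + 1) \<le> Y / real N" using near(2) by (simp add: Y_def)
    have half: "Y / real N \<le> 1 / 2" using N by (simp add: field_simps)
    have qlow: "1 / 2 \<le> norm (q N)"
    proof -
      have "1 \<le> norm (q N + 1) + norm (q N)"
        using norm_triangle_ineq4[of "q N + 1" "q N"] by simp
      with Q half show ?thesis by linarith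
    qed
    have comp: "?comp N z = Fin (p N / q N)"
      using iterated_comp_step_map[of p z q "\<epsilon> N" N, OF p0 q0 pS qS] qlow by auto
    \<comment> \<open>Comparison with the pair (- z, - 1), which represents the same point as (z,
      1): both errors in the numerator are O(1 / N).\<close>
    have "p N / q N - z = ((p N + z) - z * (q N + 1)) / q N"
    proof -
      have "q N \<noteq> 0" using qlow by auto
      then show ?thesis by (simp add: field_simps)
    qed
    then have "dist (p N / q N) z = norm ((p N + z) - z * (q N + 1)) / norm (q N)"
      by (simp add: dist_norm norm_divide)
    also have "\<dots> \<le> norm ((p N + z) - z * (q N + 1)) / (1 / 2)"
      using qlow by (intro divide_left_mono) auto
    also have "\<dots> \<le> (X / real N + R * (Y / real N)) / (1 / 2)"
    proof (intro divide_right_mono order_trans[OF norm_triangle_ineq4] add_mono P)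
      show "norm (z * (q N + 1)) \<le> R * (Y / real N)"
        unfolding norm_mult using R(1)[OF z] R(2) Q by (intro mult_mono) auto
    qed auto
    also have "\<dots> = 2 * (X + R * Y) / real N" by (simp add: add_divide_distrib algebra_simps)
    finally show ?thesis using comp by simp
  qed

  have large: "\<forall>\<^sub>F N in sequentially. c \<le> real N" for c :: real
    using filterlim_real_sequentially by (simp add: filterlim_at_top)
  have ev: "\<forall>\<^sub>F N in sequentially. \<forall>z\<in>K. ?comp N z \<noteq> Infty \<and>
      dist (finite_part (?comp N z)) z \<le> 2 * (X + R * Y) / real N"
    using eventually_ge_at_top[of N0] eventually_ge_at_top[of 4] large[of b] large[of "2 * Y"]
    by eventually_elim (use close in blast)
  show "(\<forall>\<^sub>F N in sequentially. \<forall>z\<in>K. ?comp N z \<noteq> Infty) \<and>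
      uniform_limit K (\<lambda>N z. finite_part (?comp N z)) (\<lambda>z. z) sequentially"
  proof (intro conjI uniform_limitI)
    show "\<forall>\<^sub>F N in sequentially. \<forall>z\<in>K. ?comp N z \<noteq> Infty"
      using ev by eventually_elim blast
  next
    fix e :: real
    assume "e > 0"
    then have "\<forall>\<^sub>F N in sequentially. 2 * (X + R * Y) / real N < e"
      by (rule order_tendstoD[OF lim_const_over_n])
    with ev show "\<forall>\<^sub>F N in sequentially. \<forall>z\<in>K. dist (finite_part (?comp N z)) z < e"
      by eventually_elim force
  qed
qed

end
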